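(* Let $\mathcal{A}$ be a unital associative algebra over a commutative unital ring $R$. A triple $(\sigma_1,\sigma_2,\sigma_3)$ with $\sigma_i\in \mathrm{GL}(\mathcal{A})$ for all $i$ is a ternary automorphism of $\mathcal{A}$ if and only if $$(\sigma_1,\sigma_2,\sigma_3)=(R_yL_x\sigma,\ L_x\sigma,\ R_y\sigma)$$ for a unique automorphism $\sigma\in\mathrm{Aut}(\mathcal{A})$ and unique invertible elements $x,y\in\mathcal{A}^\times$. Moreover, there is a short exact sequence of groups $$1\to(\mathcal{A}\times\mathcal{A}^{\mathrm{op}})^\times\xrightarrow{\ i\ }\mathrm{TerAut}(\mathcal{A})\xrightarrow{\ p\ }\mathrm{Aut}(\mathcal{A})\to 1,$$ where $i(x,y)=(R_yL_x,L_x,R_y)$ and $p(\sigma_1,\sigma_2,\sigma_3)=\sigma$, with $\sigma$ the automorphism associated to $(\sigma_1,\sigma_2,\sigma_3)$ by the first part.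
   Context: $\mathrm{GL}(\mathcal{A})$ is the group of invertible $R$-linear endomorphisms of $\mathcal{A}$; $\mathrm{Aut}(\mathcal{A})$ is the group of $R$-algebra automorphisms; $\mathcal{A}^\times$ is the group of invertible elements. $L_x(a)=xa$ and $R_y(a)=ay$ are the left and right multiplication operators. A triple $(\sigma_1,\sigma_2,\sigma_3)$ with $\sigma_i\in\mathrm{GL}(\mathcal{A})$ is a ternary automorphism of $\mathcal{A}$ if $\sigma_1(ab)=\sigma_2(a)\sigma_3(b)$ for all $a,b\in\mathcal{A}$; these form a group $\mathrm{TerAut}(\mathcal{A})$ under componentwise composition. $\mathcal{A}^{\mathrm{op}}$ is the opposite algebra, so the group $(\mathcal{A}\times\mathcal{A}^{\mathrm{op}})^\times$ has multiplication $(a,b)(a',b')=(aa',b'b)$. *)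

theory Defs
  imports "HOL-Algebra.Algebra"
begin

(* The library locale algebra assumes that the multiplication of the algebra is commutative,
   and so it needs only one of the two compatibility axioms.  The zero algebra and the zero
   base ring are allowed here. *)
locale assoc_algebra = module + ring M +
  assumes smult_mult_left:
      "\<lbrakk>r \<in> carrier R; a \<in> carrier M; b \<in> carrier M\<rbrakk> \<Longrightarrow>
        r \<odot>\<^bsub>M\<^esub> (a \<otimes>\<^bsub>M\<^esub> b) = (r \<odot>\<^bsub>M\<^esub> a) \<otimes>\<^bsub>M\<^esub> b"
    and smult_mult_right:
      "\<lbrakk>r \<in> carrier R; a \<in> carrier M; b \<in> carrier M\<rbrakk> \<Longrightarrow>
        r \<odot>\<^bsub>M\<^esub> (a \<otimes>\<^bsub>M\<^esub> b) = a \<otimes>\<^bsub>M\<^esub> (r \<odot>\<^bsub>M\<^esub> b)"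

(* As in the library's BijGroup and AutoGroup, a self-map of an algebra is an extensional
   function on its carrier (undefined elsewhere), so equality of maps means equality on the
   carrier, and composition is compose (carrier A). *)

definition GL :: "('r, 'm) ring_scheme \<Rightarrow> ('r, 'a, 'n) module_scheme \<Rightarrow> ('a \<Rightarrow> 'a) monoid" where
  "GL R A = BijGroup (carrier A)
     \<lparr>carrier := {f \<in> Bij (carrier A).
        (\<forall>a\<in>carrier A. \<forall>b\<in>carrier A. f (a \<oplus>\<^bsub>A\<^esub> b) = f a \<oplus>\<^bsub>A\<^esub> f b) \<and>
        (\<forall>r\<in>carrier R. \<forall>a\<in>carrier A. f (r \<odot>\<^bsub>A\<^esub> a) = r \<odot>\<^bsub>A\<^esub> f a)}\<rparr>"

definition Aut_alg :: "('r, 'm) ring_scheme \<Rightarrow> ('r, 'a, 'n) module_scheme \<Rightarrow> ('a \<Rightarrow> 'a) monoid" where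
  "Aut_alg R A = BijGroup (carrier A)
     \<lparr>carrier := {f \<in> ring_iso A A \<inter> extensional (carrier A).
        \<forall>r\<in>carrier R. \<forall>a\<in>carrier A. f (r \<odot>\<^bsub>A\<^esub> a) = r \<odot>\<^bsub>A\<^esub> f a}\<rparr>"

definition Lmul :: "('a, 'm) ring_scheme \<Rightarrow> 'a \<Rightarrow> 'a \<Rightarrow> 'a" where
  "Lmul A x = (\<lambda>a\<in>carrier A. x \<otimes>\<^bsub>A\<^esub> a)"

definition Rmul :: "('a, 'm) ring_scheme \<Rightarrow> 'a \<Rightarrow> 'a \<Rightarrow> 'a" where
  "Rmul A y = (\<lambda>a\<in>carrier A. a \<otimes>\<^bsub>A\<^esub> y)"

definition ternary_automorphism ::
  "('r, 'm) ring_scheme \<Rightarrow> ('r, 'a, 'n) module_scheme \<Rightarrow>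
    ('a \<Rightarrow> 'a) \<times> ('a \<Rightarrow> 'a) \<times> ('a \<Rightarrow> 'a) \<Rightarrow> bool" where
  "ternary_automorphism R A = (\<lambda>(s1, s2, s3).
     s1 \<in> carrier (GL R A) \<and> s2 \<in> carrier (GL R A) \<and> s3 \<in> carrier (GL R A) \<and>
     (\<forall>a\<in>carrier A. \<forall>b\<in>carrier A. s1 (a \<otimes>\<^bsub>A\<^esub> b) = s2 a \<otimes>\<^bsub>A\<^esub> s3 b))"

definition TerAut ::
  "('r, 'm) ring_scheme \<Rightarrow> ('r, 'a, 'n) module_scheme \<Rightarrow>
    (('a \<Rightarrow> 'a) \<times> ('a \<Rightarrow> 'a) \<times> ('a \<Rightarrow> 'a)) monoid" where
  "TerAut R A = (GL R A \<times>\<times> GL R A \<times>\<times> GL R A)\<lparr>carrier := {t. ternary_automorphism R A t}\<rparr>"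

definition opposite :: "('a, 'm) ring_scheme \<Rightarrow> ('a, 'm) ring_scheme" where
  "opposite A = A\<lparr>mult := \<lambda>a b. b \<otimes>\<^bsub>A\<^esub> a\<rparr>"

definition ter_incl ::
  "('a, 'm) ring_scheme \<Rightarrow> 'a \<times> 'a \<Rightarrow> ('a \<Rightarrow> 'a) \<times> ('a \<Rightarrow> 'a) \<times> ('a \<Rightarrow> 'a)" where
  "ter_incl A = (\<lambda>(x, y). (compose (carrier A) (Rmul A y) (Lmul A x), Lmul A x, Rmul A y))"

definition ter_of ::
  "('a, 'm) ring_scheme \<Rightarrow> ('a \<Rightarrow> 'a) \<Rightarrow> 'a \<Rightarrow> 'a \<Rightarrow> ('a \<Rightarrow> 'a) \<times> ('a \<Rightarrow> 'a) \<times> ('a \<Rightarrow> 'a)" where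
  "ter_of A s x y =
    (compose (carrier A) (Rmul A y) (compose (carrier A) (Lmul A x) s),
     compose (carrier A) (Lmul A x) s,
     compose (carrier A) (Rmul A y) s)"

definition ter_proj ::
  "('r, 'm) ring_scheme \<Rightarrow> ('r, 'a, 'n) module_scheme \<Rightarrow>
    ('a \<Rightarrow> 'a) \<times> ('a \<Rightarrow> 'a) \<times> ('a \<Rightarrow> 'a) \<Rightarrow> 'a \<Rightarrow> 'a" where
  "ter_proj R A t =
    (THE s. s \<in> carrier (Aut_alg R A) \<and> (\<exists>x\<in>Units A. \<exists>y\<in>Units A. t = ter_of A s x y))"

(* The library's exact_seq and short_exact_sequence need all groups to have the same element
   type, which the three groups here do not.  These are the same notions without that
   restriction. *)
definition exact_at ::
  "('a, 'm) monoid_scheme \<Rightarrow> ('b, 'n) monoid_scheme \<Rightarrow> ('c, 'k) monoid_scheme \<Rightarrow>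
    ('a \<Rightarrow> 'b) \<Rightarrow> ('b \<Rightarrow> 'c) \<Rightarrow> bool" where
  "exact_at G H K f g \<longleftrightarrow> group_hom G H f \<and> group_hom H K g \<and> kernel H K g = f ` carrier G"

definition short_exact ::
  "('a, 'm) monoid_scheme \<Rightarrow> ('b, 'n) monoid_scheme \<Rightarrow> ('c, 'k) monoid_scheme \<Rightarrow>
    ('a \<Rightarrow> 'b) \<Rightarrow> ('b \<Rightarrow> 'c) \<Rightarrow> bool" where
  "short_exact G H K f g \<longleftrightarrow>
     exact_at (singleton_group ()) G H (\<lambda>_. \<one>\<^bsub>G\<^esub>) f \<and>
     exact_at G H K f g \<and>
     exact_at H K (singleton_group ()) g (\<lambda>_. ())"

end

theory Submission
  imports Defs
begin

text \<open>
  The components of a ternary automorphism differ only by multiplications with units, which can be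
  read off at \<open>\<one>\<close>.  Given
  \<open>\<sigma>\<^sub>1 (a b) = \<sigma>\<^sub>2 a \<cdot> \<sigma>\<^sub>3 b\<close>, put \<open>x = \<sigma>\<^sub>2 \<one>\<close> and \<open>y = \<sigma>\<^sub>3 \<one>\<close>.  Setting one argument to \<open>\<one>\<close> gives
  \<open>\<sigma>\<^sub>1 = R\<^sub>y \<sigma>\<^sub>2 = L\<^sub>x \<sigma>\<^sub>3\<close>, so \<open>R\<^sub>y\<close> and \<open>L\<^sub>x\<close> are bijections, which forces \<open>x\<close> and \<open>y\<close> to be units.
  For \<open>\<sigma> = L\<^bsub>x\<inverse>\<^esub> \<sigma>\<^sub>2\<close> the identity becomes \<open>x \<cdot> \<sigma> (a b) \<cdot> y = x \<cdot> \<sigma> a \<cdot> \<sigma> b \<cdot> y\<close>, and cancelling \<open>x\<close> and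
  \<open>y\<close> shows that \<open>\<sigma>\<close> is multiplicative (\<open>ternary_automorphism_decomposition\<close>).  Conversely,
  multiplicativity of \<open>\<sigma>\<close> and associativity make \<open>(R\<^sub>y L\<^sub>x \<sigma>, L\<^sub>x \<sigma>, R\<^sub>y \<sigma>)\<close> a ternary automorphism,
  and since \<open>\<sigma> \<one> = \<one>\<close> the values of its last two components at \<open>\<one>\<close> recover \<open>x\<close> and \<open>y\<close>, hence \<open>\<sigma>\<close>
  (\<open>ter_of_inject\<close>).

  The exact sequence reflects a semidirect product: moving \<open>\<sigma>\<close> past multiplications,
  \<open>\<sigma> L\<^sub>x = L\<^bsub>\<sigma> x\<^esub> \<sigma>\<close> and \<open>\<sigma> R\<^sub>y = R\<^bsub>\<sigma> y\<^esub> \<sigma>\<close>, shows that the product of the triples of \<open>(\<sigma>, x, y)\<close> and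
  \<open>(\<tau>, u, v)\<close> is the triple of \<open>(\<sigma> \<tau>, x \<cdot> \<sigma> u, \<sigma> v \<cdot> y)\<close> (\<open>TerAut_mult_ter_of\<close>).  Thus forgetting \<open>x\<close>
  and \<open>y\<close> is a homomorphism; its kernel consists of the triples with \<open>\<sigma> = id\<close>, which are the image
  of \<open>i\<close>, and \<open>\<sigma> \<mapsto> (\<sigma>, \<sigma>, \<sigma>)\<close> splits it.
\<close>

section \<open>Bijections compatible with families of operations\<close>

text \<open>
  Three different bijections are allowed so that the lemma covers ternary automorphisms as well as
  ordinary automorphisms.
\<close>

lemma inv_into_intertwines:
  assumes bij: "f \<in> Bij S" "g \<in> Bij S" "h \<in> Bij S"
    and closed: "\<And>a b. \<lbrakk>a \<in> S; b \<in> S\<rbrakk> \<Longrightarrow> m a b \<in> S"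
    and eq: "\<And>a b. \<lbrakk>a \<in> S; b \<in> S\<rbrakk> \<Longrightarrow> f (m a b) = m (g a) (h b)"
    and "a \<in> S" "b \<in> S"
  shows "inv_into S f (m a b) = m (inv_into S g a) (inv_into S h b)"
proof -
  let ?a = "inv_into S g a" and ?b = "inv_into S h b"
  have mem: "?a \<in> S" "?b \<in> S"
    using assms by (simp_all add: Bij_inv_into_mem)
  have "g ?a = a" "h ?b = b"
    using assms by (simp_all add: Bij_def bij_betw_def f_inv_into_f)
  then have "m a b = f (m ?a ?b)"
    using eq mem by simp
  then show ?thesis
    using bij(1) closed mem by (simp add: Bij_def bij_betw_def)
qed

definition op_autos :: "'a set \<Rightarrow> ('a \<Rightarrow> 'a \<Rightarrow> 'a) set \<Rightarrow> ('a \<Rightarrow> 'a) set" where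
  "op_autos S F = {f \<in> Bij S. \<forall>m\<in>F. \<forall>a\<in>S. \<forall>b\<in>S. f (m a b) = m (f a) (f b)}"

lemma op_autos_subgroup:
  assumes closed: "\<And>m a b. \<lbrakk>m \<in> F; a \<in> S; b \<in> S\<rbrakk> \<Longrightarrow> m a b \<in> S"
  shows "subgroup (op_autos S F) (BijGroup S)"
proof (rule subgroup.intro)
  show "op_autos S F \<subseteq> carrier (BijGroup S)"
    by (auto simp: op_autos_def BijGroup_def)
next
  fix f g assume f: "f \<in> op_autos S F" and g: "g \<in> op_autos S F"
  then have "a \<in> S \<Longrightarrow> g a \<in> S" for a
    by (auto simp: op_autos_def dest: Bij_imp_funcset)
  then show "f \<otimes>\<^bsub>BijGroup S\<^esub> g \<in> op_autos S F"
    using f g closed by (auto simp: op_autos_def BijGroup_def compose_Bij compose_eq)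
next
  show "\<one>\<^bsub>BijGroup S\<^esub> \<in> op_autos S F"
    using closed by (auto simp: op_autos_def BijGroup_def id_Bij)
next
  fix f assume f: "f \<in> op_autos S F"
  then have fB: "f \<in> Bij S"
    by (simp add: op_autos_def)
  have "inv_into S f (m a b) = m (inv_into S f a) (inv_into S f b)"
    if "m \<in> F" "a \<in> S" "b \<in> S" for m a b
    using that f closed by (intro inv_into_intertwines fB) (auto simp: op_autos_def)
  then show "inv\<^bsub>BijGroup S\<^esub> f \<in> op_autos S F"
    using closed restrict_inv_into_Bij[OF fB] by (auto simp: op_autos_def inv_BijGroup[OF fB])
qed

section \<open>The groups of linear, algebra and ternary automorphisms\<close>

context assoc_algebra
begin

text \<open>
  Scalar multiplication by \<open>r\<close> enters as the binary operation that ignores its first argument, so that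
  linearity is compatibility with a set of binary operations.
\<close>

definition linear_ops where
  "linear_ops = insert (\<oplus>\<^bsub>M\<^esub>) ((\<lambda>r a b. r \<odot>\<^bsub>M\<^esub> b) ` carrier R)"

lemma linear_ops_closed:
  "\<lbrakk>m \<in> linear_ops; a \<in> carrier M; b \<in> carrier M\<rbrakk> \<Longrightarrow> m a b \<in> carrier M"
  by (auto simp: linear_ops_def)

lemma GL_eq: "GL R M = BijGroup (carrier M)\<lparr>carrier := op_autos (carrier M) linear_ops\<rparr>"
proof -
  have "carrier M \<noteq> {}"
    by blast
  then show ?thesis
    unfolding GL_def op_autos_def linear_ops_def
    by (intro arg_cong[where f = "\<lambda>C. BijGroup (carrier M)\<lparr>carrier := C\<rparr>"]) auto
qed

text \<open>
  A multiplicative bijection fixes \<open>\<one>\<close>, because it sends \<open>\<one>\<close> to an identity element of its image.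
\<close>

lemma Aut_alg_eq:
  "Aut_alg R M =
    BijGroup (carrier M)\<lparr>carrier := op_autos (carrier M) (insert (\<otimes>\<^bsub>M\<^esub>) linear_ops)\<rparr>"
proof -
  have one: "f \<one>\<^bsub>M\<^esub> = \<one>\<^bsub>M\<^esub>"
    if f: "f \<in> Bij (carrier M)"
      and m: "\<forall>a\<in>carrier M. \<forall>b\<in>carrier M. f (a \<otimes>\<^bsub>M\<^esub> b) = f a \<otimes>\<^bsub>M\<^esub> f b" for f
  proof -
    have fc: "a \<in> carrier M \<Longrightarrow> f a \<in> carrier M" for a
      using f by (auto dest: Bij_imp_funcset)
    have "\<one>\<^bsub>M\<^esub> \<in> f ` carrier M"
      using f by (simp add: Bij_def bij_betw_def)
    then obtain e where e: "e \<in> carrier M" "f e = \<one>\<^bsub>M\<^esub>"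
      by (metis imageE)
    have "f \<one>\<^bsub>M\<^esub> \<otimes>\<^bsub>M\<^esub> f e = f (\<one>\<^bsub>M\<^esub> \<otimes>\<^bsub>M\<^esub> e)"
      using bspec[OF bspec[OF m one_closed] e(1)] by (rule sym)
    then show ?thesis
      using e fc by simp
  qed
  have "carrier M \<noteq> {}"
    by blast
  then show ?thesis
    unfolding Aut_alg_def op_autos_def linear_ops_def ring_iso_def ring_hom_def
    by (intro arg_cong[where f = "\<lambda>C. BijGroup (carrier M)\<lparr>carrier := C\<rparr>"])
      (auto simp: one Bij_def dest: bij_betwE)
qed

lemma group_GL: "group (GL R M)"
  unfolding GL_eq
  by (rule subgroup.subgroup_is_group[OF op_autos_subgroup group_BijGroup]) (rule linear_ops_closed)

lemma group_Aut_alg: "group (Aut_alg R M)"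
  unfolding Aut_alg_eq
  by (rule subgroup.subgroup_is_group[OF op_autos_subgroup group_BijGroup])
    (auto simp: linear_ops_closed)

lemma Aut_alg_imp_GL: "s \<in> carrier (Aut_alg R M) \<Longrightarrow> s \<in> carrier (GL R M)"
  by (auto simp: Aut_alg_eq GL_eq op_autos_def)

lemma GL_imp_Bij: "f \<in> carrier (GL R M) \<Longrightarrow> f \<in> Bij (carrier M)"
  by (simp add: GL_def)

lemma GL_closed: "\<lbrakk>f \<in> carrier (GL R M); a \<in> carrier M\<rbrakk> \<Longrightarrow> f a \<in> carrier M"
  by (auto dest!: GL_imp_Bij Bij_imp_funcset)

lemma GL_surj:
  assumes "f \<in> carrier (GL R M)" "b \<in> carrier M"
  obtains a where "a \<in> carrier M" "f a = b"
proof -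
  have "b \<in> f ` carrier M"
    using GL_imp_Bij[OF assms(1)] assms(2) by (simp add: Bij_def bij_betw_def)
  then show thesis
    using that by blast
qed

lemma GL_mult:
  "\<lbrakk>f \<in> carrier (GL R M); g \<in> carrier (GL R M)\<rbrakk>
    \<Longrightarrow> f \<otimes>\<^bsub>GL R M\<^esub> g = compose (carrier M) f g"
  by (simp add: GL_def BijGroup_def)

lemma GL_compose:
  "\<lbrakk>f \<in> carrier (GL R M); g \<in> carrier (GL R M)\<rbrakk> \<Longrightarrow> compose (carrier M) f g \<in> carrier (GL R M)"
  using monoid.m_closed[OF group.is_monoid[OF group_GL], of f g] by (simp add: GL_mult)

lemma GL_inv:
  assumes f: "f \<in> carrier (GL R M)"
  shows "inv\<^bsub>GL R M\<^esub> f = (\<lambda>a\<in>carrier M. inv_into (carrier M) f a)"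
proof -
  have sub: "subgroup (op_autos (carrier M) linear_ops) (BijGroup (carrier M))"
    by (rule op_autos_subgroup) (rule linear_ops_closed)
  show ?thesis
    using group.m_inv_consistent[OF group_BijGroup sub] f inv_BijGroup[OF GL_imp_Bij[OF f]]
    by (simp add: GL_eq)
qed

lemma GL_eqI:
  assumes "f \<in> carrier (GL R M)" "g \<in> carrier (GL R M)" "\<And>a. a \<in> carrier M \<Longrightarrow> f a = g a"
  shows "f = g"
  using assms by (intro extensionalityI[of f "carrier M" g] Bij_imp_extensional GL_imp_Bij)

lemma Aut_alg_closed: "\<lbrakk>s \<in> carrier (Aut_alg R M); a \<in> carrier M\<rbrakk> \<Longrightarrow> s a \<in> carrier M"
  by (simp add: Aut_alg_imp_GL GL_closed)

lemma Aut_alg_hom_mult: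
  "\<lbrakk>s \<in> carrier (Aut_alg R M); a \<in> carrier M; b \<in> carrier M\<rbrakk>
    \<Longrightarrow> s (a \<otimes>\<^bsub>M\<^esub> b) = s a \<otimes>\<^bsub>M\<^esub> s b"
  by (simp add: Aut_alg_def ring_iso_memE(2))

lemma Aut_alg_hom_one: "s \<in> carrier (Aut_alg R M) \<Longrightarrow> s \<one>\<^bsub>M\<^esub> = \<one>\<^bsub>M\<^esub>"
  by (simp add: Aut_alg_def ring_iso_memE(4))

lemma Aut_alg_Units:
  assumes s: "s \<in> carrier (Aut_alg R M)" and x: "x \<in> Units M"
  shows "s x \<in> Units M"
proof -
  obtain z where z: "z \<in> carrier M" "z \<otimes>\<^bsub>M\<^esub> x = \<one>\<^bsub>M\<^esub>" "x \<otimes>\<^bsub>M\<^esub> z = \<one>\<^bsub>M\<^esub>" and xc: "x \<in> carrier M"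
    using x by (auto simp: Units_def)
  have "s z \<otimes>\<^bsub>M\<^esub> s x = \<one>\<^bsub>M\<^esub>" "s x \<otimes>\<^bsub>M\<^esub> s z = \<one>\<^bsub>M\<^esub>"
    using z xc Aut_alg_hom_mult[OF s, symmetric] Aut_alg_hom_one[OF s] by simp_all
  then show ?thesis
    using z(1) xc Aut_alg_closed[OF s] by (auto simp: Units_def)
qed

lemma Aut_algI:
  assumes "s \<in> carrier (GL R M)"
    and "\<And>a b. \<lbrakk>a \<in> carrier M; b \<in> carrier M\<rbrakk> \<Longrightarrow> s (a \<otimes>\<^bsub>M\<^esub> b) = s a \<otimes>\<^bsub>M\<^esub> s b"
  shows "s \<in> carrier (Aut_alg R M)"
  using assms by (auto simp: Aut_alg_eq GL_eq op_autos_def)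

lemma Aut_alg_mult:
  "\<lbrakk>s \<in> carrier (Aut_alg R M); t \<in> carrier (Aut_alg R M)\<rbrakk>
    \<Longrightarrow> s \<otimes>\<^bsub>Aut_alg R M\<^esub> t = compose (carrier M) s t"
  using GL_imp_Bij[OF Aut_alg_imp_GL, of s] GL_imp_Bij[OF Aut_alg_imp_GL, of t]
  by (simp add: Aut_alg_def BijGroup_def)

lemma Aut_alg_one: "\<one>\<^bsub>Aut_alg R M\<^esub> = (\<lambda>a\<in>carrier M. a)"
  by (simp add: Aut_alg_def BijGroup_def)

lemma Aut_alg_one_closed: "(\<lambda>a\<in>carrier M. a) \<in> carrier (Aut_alg R M)"
  using monoid.one_closed[OF group.is_monoid[OF group_Aut_alg]] by (simp add: Aut_alg_one)

text \<open>
  Closure under inverses comes from \<open>inv_into_intertwines\<close>, applied to the three components.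
\<close>

lemma TerAut_subgroup:
  "subgroup {t. ternary_automorphism R M t} (GL R M \<times>\<times> GL R M \<times>\<times> GL R M)"
proof (rule subgroup.intro)
  show "{t. ternary_automorphism R M t} \<subseteq> carrier (GL R M \<times>\<times> GL R M \<times>\<times> GL R M)"
    by (auto simp: ternary_automorphism_def)
next
  fix t u assume "t \<in> {t. ternary_automorphism R M t}" "u \<in> {t. ternary_automorphism R M t}"
  then show "t \<otimes>\<^bsub>GL R M \<times>\<times> GL R M \<times>\<times> GL R M\<^esub> u \<in> {t. ternary_automorphism R M t}"
    by (cases t; cases u)
      (auto simp: ternary_automorphism_def GL_mult GL_compose compose_eq GL_closed)
next
  show "\<one>\<^bsub>GL R M \<times>\<times> GL R M \<times>\<times> GL R M\<^esub> \<in> {t. ternary_automorphism R M t}"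
    using Aut_alg_imp_GL[OF Aut_alg_one_closed]
    by (simp add: ternary_automorphism_def GL_def BijGroup_def)
next
  fix t assume t: "t \<in> {t. ternary_automorphism R M t}"
  obtain s1 s2 s3 where t_eq: "t = (s1, s2, s3)"
    by (cases t)
  have GL: "s1 \<in> carrier (GL R M)" "s2 \<in> carrier (GL R M)" "s3 \<in> carrier (GL R M)"
    and eq: "\<And>a b. \<lbrakk>a \<in> carrier M; b \<in> carrier M\<rbrakk> \<Longrightarrow> s1 (a \<otimes>\<^bsub>M\<^esub> b) = s2 a \<otimes>\<^bsub>M\<^esub> s3 b"
    using t by (auto simp: t_eq ternary_automorphism_def)
  have inv_GL: "inv\<^bsub>GL R M\<^esub> f \<in> carrier (GL R M)" if "f \<in> carrier (GL R M)" for f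
    using that by (rule group.inv_closed[OF group_GL])
  have "inv_into (carrier M) s1 (a \<otimes>\<^bsub>M\<^esub> b) = inv_into (carrier M) s2 a \<otimes>\<^bsub>M\<^esub> inv_into (carrier M) s3 b"
    if "a \<in> carrier M" "b \<in> carrier M" for a b
    using GL eq that by (intro inv_into_intertwines GL_imp_Bij) auto
  then show "inv\<^bsub>GL R M \<times>\<times> GL R M \<times>\<times> GL R M\<^esub> t \<in> {t. ternary_automorphism R M t}"
    using GL inv_GL[OF GL(1)] inv_GL[OF GL(2)] inv_GL[OF GL(3)]
    by (simp add: t_eq group_GL DirProd_group ternary_automorphism_def GL_inv)
qed

lemma group_TerAut: "group (TerAut R M)"
  unfolding TerAut_def
  by (rule subgroup.subgroup_is_group[OF TerAut_subgroup]) (intro DirProd_group group_GL)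

section \<open>Decomposition of ternary automorphisms\<close>

lemma Lmul_GL:
  assumes x: "x \<in> Units M"
  shows "Lmul M x \<in> carrier (GL R M)"
proof -
  have xc: "x \<in> carrier M"
    using x by blast
  have "bij_betw (\<lambda>a. x \<otimes>\<^bsub>M\<^esub> a) (carrier M) (carrier M)"
    by (rule bij_betw_byWitness[where f' = "\<lambda>a. inv\<^bsub>M\<^esub> x \<otimes>\<^bsub>M\<^esub> a"])
      (use x xc in \<open>auto simp: m_assoc[symmetric]\<close>)
  then have "Lmul M x \<in> Bij (carrier M)"
    by (simp add: Lmul_def Bij_def)
  then show ?thesis
    using xc by (simp add: GL_def Lmul_def r_distr smult_mult_right)
qed

lemma Rmul_GL:
  assumes y: "y \<in> Units M"
  shows "Rmul M y \<in> carrier (GL R M)"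
proof -
  have yc: "y \<in> carrier M"
    using y by blast
  have "bij_betw (\<lambda>a. a \<otimes>\<^bsub>M\<^esub> y) (carrier M) (carrier M)"
    by (rule bij_betw_byWitness[where f' = "\<lambda>a. a \<otimes>\<^bsub>M\<^esub> inv\<^bsub>M\<^esub> y"])
      (use y yc in \<open>auto simp: m_assoc\<close>)
  then have "Rmul M y \<in> Bij (carrier M)"
    by (simp add: Rmul_def Bij_def)
  then show ?thesis
    using yc by (simp add: GL_def Rmul_def l_distr smult_mult_left)
qed

lemma ternary_automorphism_ter_of:
  assumes s: "s \<in> carrier (Aut_alg R M)" and x: "x \<in> Units M" and y: "y \<in> Units M"
  shows "ternary_automorphism R M (ter_of M s x y)"
proof -
  have c: "x \<in> carrier M" "y \<in> carrier M"
    using x y by blast+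
  then show ?thesis
    using s x y
    by (simp add: ternary_automorphism_def ter_of_def GL_compose Lmul_GL Rmul_GL Aut_alg_imp_GL
        compose_eq Lmul_def[of M x] Rmul_def[of M y] Aut_alg_closed Aut_alg_hom_mult m_assoc
        Lmul_GL[unfolded Lmul_def] Rmul_GL[unfolded Rmul_def])
qed

text \<open>
  The values \<open>x = \<sigma>\<^sub>2 \<one>\<close> and \<open>y = \<sigma>\<^sub>3 \<one>\<close> are units because \<open>\<sigma>\<^sub>1 = R\<^sub>y \<sigma>\<^sub>2 = L\<^sub>x \<sigma>\<^sub>3\<close> with all three maps
  bijective; dividing \<open>\<sigma>\<^sub>2\<close> by \<open>x\<close> on the left then leaves a map that \<open>\<sigma>\<^sub>3\<close> shares up to the factor
  \<open>y\<close>, and the ternary identity says that it is multiplicative.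
\<close>

lemma ternary_automorphism_decomposition:
  assumes "ternary_automorphism R M t"
  shows "\<exists>s\<in>carrier (Aut_alg R M). \<exists>x\<in>Units M. \<exists>y\<in>Units M. t = ter_of M s x y"
proof -
  obtain s1 s2 s3 where t_eq: "t = (s1, s2, s3)"
    by (cases t)
  have GL: "s1 \<in> carrier (GL R M)" "s2 \<in> carrier (GL R M)" "s3 \<in> carrier (GL R M)"
    and eq: "\<And>a b. \<lbrakk>a \<in> carrier M; b \<in> carrier M\<rbrakk> \<Longrightarrow> s1 (a \<otimes>\<^bsub>M\<^esub> b) = s2 a \<otimes>\<^bsub>M\<^esub> s3 b"
    using assms by (auto simp: t_eq ternary_automorphism_def)
  have inj1: "inj_on s1 (carrier M)"
    using GL_imp_Bij[OF GL(1)] by (simp add: Bij_def bij_betw_def)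
  define x where "x = s2 \<one>\<^bsub>M\<^esub>"
  define y where "y = s3 \<one>\<^bsub>M\<^esub>"
  have xc: "x \<in> carrier M" and yc: "y \<in> carrier M"
    using GL by (simp_all add: x_def y_def GL_closed)
  have s1_s2: "s1 a = s2 a \<otimes>\<^bsub>M\<^esub> y" and s1_s3: "s1 a = x \<otimes>\<^bsub>M\<^esub> s3 a" if "a \<in> carrier M" for a
    using eq[OF that one_closed] eq[OF one_closed that] that by (simp_all add: x_def y_def)

  have y: "y \<in> Units M"
  proof -
    obtain a where a: "a \<in> carrier M" "s1 a = \<one>\<^bsub>M\<^esub>"
      using GL_surj[OF GL(1) one_closed] .
    \<comment> \<open>Surjectivity of right multiplication by \<open>y\<close> gives only a left inverse \<open>z\<close>; both \<open>y z\<close> and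
      \<open>\<one>\<close> are sent to \<open>y\<close>, so injectivity makes \<open>z\<close> two-sided.\<close>
    define z where "z = s2 a"
    have z: "z \<in> carrier M" "z \<otimes>\<^bsub>M\<^esub> y = \<one>\<^bsub>M\<^esub>"
      using a GL s1_s2 by (simp_all add: z_def GL_closed)
    obtain b where b: "b \<in> carrier M" "s2 b = y \<otimes>\<^bsub>M\<^esub> z"
      using GL_surj[OF GL(2) m_closed[OF yc z(1)]] .
    obtain c where c: "c \<in> carrier M" "s2 c = \<one>\<^bsub>M\<^esub>"
      using GL_surj[OF GL(2) one_closed] .
    have "s1 b = s1 c"
      using b c z yc by (simp add: s1_s2 m_assoc)
    then have "b = c"
      using inj1 b(1) c(1) by (simp add: inj_on_eq_iff)
    then have "y \<otimes>\<^bsub>M\<^esub> z = \<one>\<^bsub>M\<^esub>"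
      using b c by simp
    then show ?thesis
      using z yc by (auto simp: Units_def)
  qed
  have x: "x \<in> Units M"
  proof -
    obtain a where a: "a \<in> carrier M" "s1 a = \<one>\<^bsub>M\<^esub>"
      using GL_surj[OF GL(1) one_closed] .
    define z where "z = s3 a"
    have z: "z \<in> carrier M" "x \<otimes>\<^bsub>M\<^esub> z = \<one>\<^bsub>M\<^esub>"
      using a GL s1_s3 by (simp_all add: z_def GL_closed)
    obtain b where b: "b \<in> carrier M" "s3 b = z \<otimes>\<^bsub>M\<^esub> x"
      using GL_surj[OF GL(3) m_closed[OF z(1) xc]] .
    obtain c where c: "c \<in> carrier M" "s3 c = \<one>\<^bsub>M\<^esub>"
      using GL_surj[OF GL(3) one_closed] .
    have "s1 b = s1 c"
      using b c z xc by (simp add: s1_s3 m_assoc[symmetric])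
    then have "b = c"
      using inj1 b(1) c(1) by (simp add: inj_on_eq_iff)
    then have "z \<otimes>\<^bsub>M\<^esub> x = \<one>\<^bsub>M\<^esub>"
      using b c by simp
    then show ?thesis
      using z xc by (auto simp: Units_def)
  qed

  define s where "s = compose (carrier M) (Lmul M (inv\<^bsub>M\<^esub> x)) s2"
  have sGL: "s \<in> carrier (GL R M)"
    using x GL by (simp add: s_def GL_compose Lmul_GL)
  have sc: "s a \<in> carrier M" if "a \<in> carrier M" for a
    using that sGL by (rule GL_closed[rotated])
  have s2: "s2 a = x \<otimes>\<^bsub>M\<^esub> s a" if "a \<in> carrier M" for a
    using that x xc GL by (simp add: s_def compose_eq Lmul_def GL_closed m_assoc[symmetric])
  have s3: "s3 a = s a \<otimes>\<^bsub>M\<^esub> y" if "a \<in> carrier M" for a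
  proof -
    have "x \<otimes>\<^bsub>M\<^esub> s3 a = x \<otimes>\<^bsub>M\<^esub> (s a \<otimes>\<^bsub>M\<^esub> y)"
      using that xc yc sc s1_s2[OF that] s1_s3[OF that] by (simp add: s2 m_assoc)
    then show ?thesis
      using that x yc sc GL by (simp add: Units_l_cancel GL_closed)
  qed
  have "s (a \<otimes>\<^bsub>M\<^esub> b) = s a \<otimes>\<^bsub>M\<^esub> s b" if ab: "a \<in> carrier M" "b \<in> carrier M" for a b
  proof -
    have "x \<otimes>\<^bsub>M\<^esub> s3 (a \<otimes>\<^bsub>M\<^esub> b) = s2 a \<otimes>\<^bsub>M\<^esub> s3 b"
      using ab eq s1_s3[of "a \<otimes>\<^bsub>M\<^esub> b"] by simp
    then have "x \<otimes>\<^bsub>M\<^esub> (s (a \<otimes>\<^bsub>M\<^esub> b) \<otimes>\<^bsub>M\<^esub> y) = x \<otimes>\<^bsub>M\<^esub> (s a \<otimes>\<^bsub>M\<^esub> s b \<otimes>\<^bsub>M\<^esub> y)"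
      using ab xc yc sc by (simp add: s2 s3 m_assoc)
    then have "s (a \<otimes>\<^bsub>M\<^esub> b) \<otimes>\<^bsub>M\<^esub> y = s a \<otimes>\<^bsub>M\<^esub> s b \<otimes>\<^bsub>M\<^esub> y"
      using ab x yc sc by (simp add: Units_l_cancel)
    then have "s (a \<otimes>\<^bsub>M\<^esub> b) \<otimes>\<^bsub>M\<^esub> y \<otimes>\<^bsub>M\<^esub> inv\<^bsub>M\<^esub> y = s a \<otimes>\<^bsub>M\<^esub> s b \<otimes>\<^bsub>M\<^esub> y \<otimes>\<^bsub>M\<^esub> inv\<^bsub>M\<^esub> y"
      by simp
    then show ?thesis
      using ab y yc sc by (simp add: m_assoc)
  qed
  with sGL have sA: "s \<in> carrier (Aut_alg R M)"
    by (rule Aut_algI)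
  have "s1 = compose (carrier M) (Rmul M y) (compose (carrier M) (Lmul M x) s)"
    using GL sGL x y xc sc
    by (intro GL_eqI) (simp_all add: GL_compose Lmul_GL Rmul_GL compose_eq Lmul_def[of M x]
        Rmul_def[of M y] s1_s2 s2 Lmul_GL[unfolded Lmul_def] Rmul_GL[unfolded Rmul_def])
  moreover have "s2 = compose (carrier M) (Lmul M x) s"
    using GL sGL x sc by (intro GL_eqI GL_compose Lmul_GL) (simp_all add: compose_eq Lmul_def s2)
  moreover have "s3 = compose (carrier M) (Rmul M y) s"
    using GL sGL y sc by (intro GL_eqI GL_compose Rmul_GL) (simp_all add: compose_eq Rmul_def s3)
  ultimately have "t = ter_of M s x y"
    by (simp add: t_eq ter_of_def)
  then show ?thesis
    using sA x y by blast
qed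

text \<open>
  Evaluating \<open>L\<^sub>x \<sigma>\<close> and \<open>R\<^sub>y \<sigma>\<close> at \<open>\<one>\<close> returns \<open>x\<close> and \<open>y\<close>, and \<open>\<sigma>\<close> follows by cancelling \<open>x\<close>.
\<close>

lemma ter_of_inject:
  assumes s: "s \<in> carrier (Aut_alg R M)" "s' \<in> carrier (Aut_alg R M)"
    and x: "x \<in> Units M" "x' \<in> Units M" and y: "y \<in> Units M" "y' \<in> Units M"
    and eq: "ter_of M s x y = ter_of M s' x' y'"
  shows "s = s' \<and> x = x' \<and> y = y'"
proof -
  have c: "x \<in> carrier M" "x' \<in> carrier M" "y \<in> carrier M" "y' \<in> carrier M"
    using x y by blast+
  have L: "x \<otimes>\<^bsub>M\<^esub> s a = x' \<otimes>\<^bsub>M\<^esub> s' a" and R: "s a \<otimes>\<^bsub>M\<^esub> y = s' a \<otimes>\<^bsub>M\<^esub> y'"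
    if a: "a \<in> carrier M" for a
  proof -
    have "compose (carrier M) (Lmul M x) s a = compose (carrier M) (Lmul M x') s' a"
      and "compose (carrier M) (Rmul M y) s a = compose (carrier M) (Rmul M y') s' a"
      using eq by (simp_all add: ter_of_def)
    then show "x \<otimes>\<^bsub>M\<^esub> s a = x' \<otimes>\<^bsub>M\<^esub> s' a" "s a \<otimes>\<^bsub>M\<^esub> y = s' a \<otimes>\<^bsub>M\<^esub> y'"
      using a s by (simp_all add: compose_eq Lmul_def Rmul_def Aut_alg_closed)
  qed
  have xx: "x = x'" and yy: "y = y'"
    using L[OF one_closed] R[OF one_closed] c s by (simp_all add: Aut_alg_hom_one)
  have "s = s'"
  proof (rule GL_eqI)
    fix a assume "a \<in> carrier M"
    then show "s a = s' a"
      using L[of a] x xx s by (simp add: Units_l_cancel Aut_alg_closed)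
  qed (use s in \<open>simp_all add: Aut_alg_imp_GL\<close>)
  with xx yy show ?thesis
    by simp
qed

section \<open>The exact sequence\<close>

lemma carrier_TerAut_iff:
  "t \<in> carrier (TerAut R M) \<longleftrightarrow>
    (\<exists>s\<in>carrier (Aut_alg R M). \<exists>x\<in>Units M. \<exists>y\<in>Units M. t = ter_of M s x y)"
proof -
  have "t \<in> carrier (TerAut R M) \<longleftrightarrow> ternary_automorphism R M t"
    by (simp add: TerAut_def)
  then show ?thesis
    using ternary_automorphism_decomposition ternary_automorphism_ter_of by blast
qed

lemma ter_of_TerAut:
  "\<lbrakk>s \<in> carrier (Aut_alg R M); x \<in> Units M; y \<in> Units M\<rbrakk>
    \<Longrightarrow> ter_of M s x y \<in> carrier (TerAut R M)"
  by (simp add: TerAut_def ternary_automorphism_ter_of)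

lemma ter_proj_ter_of:
  assumes "s \<in> carrier (Aut_alg R M)" "x \<in> Units M" "y \<in> Units M"
  shows "ter_proj R M (ter_of M s x y) = s"
  unfolding ter_proj_def
  by (rule the_equality) (use assms ter_of_inject in blast)+

text \<open>
  The semidirect product law.  The factor \<open>\<sigma> v \<cdot> y\<close> appears in reversed order because
  \<open>R\<^sub>y R\<^sub>z = R\<^bsub>z y\<^esub>\<close>; this is where the opposite algebra comes from.
\<close>

lemma TerAut_mult_ter_of:
  assumes s: "s \<in> carrier (Aut_alg R M)" "x \<in> Units M" "y \<in> Units M"
    and t: "t \<in> carrier (Aut_alg R M)" "u \<in> Units M" "v \<in> Units M"
  shows "ter_of M s x y \<otimes>\<^bsub>TerAut R M\<^esub> ter_of M t u v =
    ter_of M (compose (carrier M) s t) (x \<otimes>\<^bsub>M\<^esub> s u) (s v \<otimes>\<^bsub>M\<^esub> y)"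
proof -
  have c: "x \<in> carrier M" "y \<in> carrier M" "u \<in> carrier M" "v \<in> carrier M"
    using s t by blast+
  have L: "compose (carrier M) (Lmul M z) f \<in> carrier (GL R M)"
    and R: "compose (carrier M) (Rmul M z) f \<in> carrier (GL R M)"
    if "z \<in> Units M" "f \<in> carrier (GL R M)" for z f
    using that by (simp_all add: GL_compose Lmul_GL Rmul_GL)
  have "ter_of M s x y \<otimes>\<^bsub>TerAut R M\<^esub> ter_of M t u v =
    (compose (carrier M) (compose (carrier M) (Rmul M y) (compose (carrier M) (Lmul M x) s))
       (compose (carrier M) (Rmul M v) (compose (carrier M) (Lmul M u) t)),
     compose (carrier M) (compose (carrier M) (Lmul M x) s) (compose (carrier M) (Lmul M u) t),
     compose (carrier M) (compose (carrier M) (Rmul M y) s) (compose (carrier M) (Rmul M v) t))"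
    using s t by (simp add: TerAut_def ter_of_def GL_mult L R Aut_alg_imp_GL)
  also have "\<dots> = ter_of M (compose (carrier M) s t) (x \<otimes>\<^bsub>M\<^esub> s u) (s v \<otimes>\<^bsub>M\<^esub> y)"
    using s(1) t(1) c
    by (auto simp: ter_of_def fun_eq_iff compose_def Lmul_def Rmul_def Aut_alg_closed
        Aut_alg_hom_mult m_assoc)
  finally show ?thesis .
qed

lemma ter_incl_eq_ter_of:
  assumes "x \<in> Units M" "y \<in> Units M"
  shows "ter_incl M (x, y) = ter_of M (\<lambda>a\<in>carrier M. a) x y"
  using assms Units_closed
  by (auto simp: ter_incl_def ter_of_def compose_def Lmul_def Rmul_def fun_eq_iff)

lemma Units_RDirProd_opposite: "Units (RDirProd M (opposite M)) = Units M \<times> Units M"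
  by (auto simp: Units_def RDirProd_def DirProd_def monoid.defs opposite_def)

lemma group_units_RDirProd_opposite: "group (units_of (RDirProd M (opposite M)))"
proof -
  have "monoid (opposite M)"
    by (rule monoidI) (auto simp: opposite_def m_assoc)
  then have "monoid (M \<times>\<times> opposite M)"
    by (intro DirProd_monoid monoid_axioms)
  then have "monoid (RDirProd M (opposite M))"
    unfolding monoid_def by (auto simp add: DirProd_def RDirProd_def monoid.defs)
  then show ?thesis
    by (rule monoid.units_group)
qed

lemma units_RDirProd_opposite_mult:
  "(x, y) \<otimes>\<^bsub>units_of (RDirProd M (opposite M))\<^esub> (u, v) = (x \<otimes>\<^bsub>M\<^esub> u, v \<otimes>\<^bsub>M\<^esub> y)"
  by (simp add: units_of_def RDirProd_def DirProd_def monoid.defs opposite_def)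

lemma units_RDirProd_opposite_one:
  "\<one>\<^bsub>units_of (RDirProd M (opposite M))\<^esub> = (\<one>\<^bsub>M\<^esub>, \<one>\<^bsub>M\<^esub>)"
  by (simp add: units_of_def RDirProd_def DirProd_def monoid.defs opposite_def)

lemma TerAut_one: "\<one>\<^bsub>TerAut R M\<^esub> = ter_of M (\<lambda>a\<in>carrier M. a) \<one>\<^bsub>M\<^esub> \<one>\<^bsub>M\<^esub>"
  by (auto simp: TerAut_def GL_def BijGroup_def ter_of_def compose_def Lmul_def Rmul_def fun_eq_iff)

lemma ter_incl_hom: "ter_incl M \<in> hom (units_of (RDirProd M (opposite M))) (TerAut R M)"
proof (rule homI)
  fix p assume "p \<in> carrier (units_of (RDirProd M (opposite M)))"
  then show "ter_incl M p \<in> carrier (TerAut R M)"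
    using Aut_alg_one_closed
    by (auto simp: units_of_carrier Units_RDirProd_opposite ter_incl_eq_ter_of ter_of_TerAut)
next
  fix p q
  assume "p \<in> carrier (units_of (RDirProd M (opposite M)))"
    "q \<in> carrier (units_of (RDirProd M (opposite M)))"
  then obtain x y u v where pq: "p = (x, y)" "q = (u, v)"
    and U: "x \<in> Units M" "y \<in> Units M" "u \<in> Units M" "v \<in> Units M"
    by (auto simp: units_of_carrier Units_RDirProd_opposite)
  have "compose (carrier M) (\<lambda>a\<in>carrier M. a) (\<lambda>a\<in>carrier M. a) = (\<lambda>a\<in>carrier M. a)"
    by (auto simp: compose_def)
  then show "ter_incl M (p \<otimes>\<^bsub>units_of (RDirProd M (opposite M))\<^esub> q) =
      ter_incl M p \<otimes>\<^bsub>TerAut R M\<^esub> ter_incl M q"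
    using U Aut_alg_one_closed Units_closed
    by (simp add: pq units_RDirProd_opposite_mult ter_incl_eq_ter_of TerAut_mult_ter_of)
qed

lemma ter_proj_hom: "ter_proj R M \<in> hom (TerAut R M) (Aut_alg R M)"
proof (rule homI)
  fix t assume "t \<in> carrier (TerAut R M)"
  then show "ter_proj R M t \<in> carrier (Aut_alg R M)"
    by (auto simp: carrier_TerAut_iff ter_proj_ter_of)
next
  fix p q assume "p \<in> carrier (TerAut R M)" "q \<in> carrier (TerAut R M)"
  then obtain s x y t u v where pq: "p = ter_of M s x y" "q = ter_of M t u v"
    and s: "s \<in> carrier (Aut_alg R M)" "x \<in> Units M" "y \<in> Units M"
    and t: "t \<in> carrier (Aut_alg R M)" "u \<in> Units M" "v \<in> Units M"
    unfolding carrier_TerAut_iff by blast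
  have "compose (carrier M) s t \<in> carrier (Aut_alg R M)"
    using s(1) t(1) monoid.m_closed[OF group.is_monoid[OF group_Aut_alg], of s t]
    by (simp add: Aut_alg_mult)
  then show "ter_proj R M (p \<otimes>\<^bsub>TerAut R M\<^esub> q) =
      ter_proj R M p \<otimes>\<^bsub>Aut_alg R M\<^esub> ter_proj R M q"
    using s t by (simp add: pq TerAut_mult_ter_of ter_proj_ter_of Aut_alg_Units Aut_alg_mult)
qed

text \<open>
  The identity triple comes from the parameters \<open>(id, \<one>, \<one>)\<close>, so injectivity of \<open>i\<close> is an instance of
  the uniqueness of the decomposition.
\<close>

lemma kernel_ter_incl:
  "kernel (units_of (RDirProd M (opposite M))) (TerAut R M) (ter_incl M) = {(\<one>\<^bsub>M\<^esub>, \<one>\<^bsub>M\<^esub>)}"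
proof -
  have "p = (\<one>\<^bsub>M\<^esub>, \<one>\<^bsub>M\<^esub>) \<longleftrightarrow> ter_incl M p = \<one>\<^bsub>TerAut R M\<^esub>" if pU: "p \<in> Units M \<times> Units M" for p
  proof -
    obtain x y where p: "p = (x, y)" "x \<in> Units M" "y \<in> Units M"
      using pU by blast
    show ?thesis
      using p ter_of_inject[OF Aut_alg_one_closed Aut_alg_one_closed, of x "\<one>\<^bsub>M\<^esub>" y "\<one>\<^bsub>M\<^esub>"]
      by (auto simp: TerAut_one ter_incl_eq_ter_of)
  qed
  then show ?thesis
    by (auto simp: kernel_def units_of_carrier Units_RDirProd_opposite)
qed

text \<open>
  Since \<open>p\<close> reads off the parameter \<open>\<sigma>\<close>, its kernel consists of the triples with \<open>\<sigma> = id\<close>, and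
  these are \<open>(R\<^sub>y L\<^sub>x, L\<^sub>x, R\<^sub>y)\<close>.
\<close>

lemma kernel_ter_proj:
  "kernel (TerAut R M) (Aut_alg R M) (ter_proj R M) =
    ter_incl M ` carrier (units_of (RDirProd M (opposite M)))"
proof (intro equalityI subsetI)
  fix t assume "t \<in> kernel (TerAut R M) (Aut_alg R M) (ter_proj R M)"
  then obtain x y where U: "x \<in> Units M" "y \<in> Units M"
    and t: "t = ter_of M (\<lambda>a\<in>carrier M. a) x y"
    by (auto simp: kernel_def carrier_TerAut_iff ter_proj_ter_of Aut_alg_one)
  have "t = ter_incl M (x, y)"
    using U t by (simp add: ter_incl_eq_ter_of)
  then show "t \<in> ter_incl M ` carrier (units_of (RDirProd M (opposite M)))"
    using U by (simp add: units_of_carrier Units_RDirProd_opposite)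
next
  fix t assume "t \<in> ter_incl M ` carrier (units_of (RDirProd M (opposite M)))"
  then obtain x y where U: "x \<in> Units M" "y \<in> Units M" and t: "t = ter_incl M (x, y)"
    by (auto simp: units_of_carrier Units_RDirProd_opposite)
  then show "t \<in> kernel (TerAut R M) (Aut_alg R M) (ter_proj R M)"
    using Aut_alg_one_closed
    by (auto simp: kernel_def ter_of_TerAut ter_incl_eq_ter_of ter_proj_ter_of Aut_alg_one)
qed

lemma ter_proj_surj: "ter_proj R M ` carrier (TerAut R M) = carrier (Aut_alg R M)"
proof (intro equalityI subsetI)
  fix s assume s: "s \<in> carrier (Aut_alg R M)"
  then have "s = ter_proj R M (ter_of M s \<one>\<^bsub>M\<^esub> \<one>\<^bsub>M\<^esub>)"
    by (simp add: ter_proj_ter_of)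
  moreover have "ter_of M s \<one>\<^bsub>M\<^esub> \<one>\<^bsub>M\<^esub> \<in> carrier (TerAut R M)"
    using s by (simp add: ter_of_TerAut)
  ultimately show "s \<in> ter_proj R M ` carrier (TerAut R M)"
    by (rule image_eqI)
qed (use ter_proj_hom in \<open>auto simp: hom_def\<close>)

lemma short_exact_TerAut:
  "short_exact (units_of (RDirProd M (opposite M))) (TerAut R M) (Aut_alg R M)
    (ter_incl M) (ter_proj R M)"
proof -
  let ?U = "units_of (RDirProd M (opposite M))"
  have i: "group_hom ?U (TerAut R M) (ter_incl M)"
    by (intro group_hom.intro group_hom_axioms.intro group_units_RDirProd_opposite group_TerAut
        ter_incl_hom)
  have p: "group_hom (TerAut R M) (Aut_alg R M) (ter_proj R M)"
    by (intro group_hom.intro group_hom_axioms.intro group_Aut_alg group_TerAut ter_proj_hom)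
  have triv_U: "group_hom (singleton_group ()) ?U (\<lambda>_. \<one>\<^bsub>?U\<^esub>)"
    using group.is_monoid[OF group_units_RDirProd_opposite]
    by (intro group_hom.intro group_hom_axioms.intro group_units_RDirProd_opposite singleton_group)
      (simp add: hom_def monoid.one_closed monoid.l_one)
  have Aut_triv: "group_hom (Aut_alg R M) (singleton_group ()) (\<lambda>_. ())"
    by (intro group_hom.intro group_hom_axioms.intro group_Aut_alg singleton_group)
      (simp add: group_Aut_alg)
  show ?thesis
    unfolding short_exact_def exact_at_def
    using i p triv_U Aut_triv kernel_ter_incl kernel_ter_proj ter_proj_surj
    by (simp add: units_RDirProd_opposite_one kernel_def[of "Aut_alg R M"] singleton_group_def)
qed

end

theorem theorem3p1:
  fixes R :: "('r, 'm) ring_scheme" and A :: "('r, 'a, 'n) module_scheme"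
  assumes "assoc_algebra R A"
  shows "(\<forall>s1\<in>carrier (GL R A). \<forall>s2\<in>carrier (GL R A). \<forall>s3\<in>carrier (GL R A).
          (ternary_automorphism R A (s1, s2, s3) \<longleftrightarrow>
            (\<exists>!(s, x, y)\<in>carrier (Aut_alg R A) \<times> Units A \<times> Units A.
              (s1, s2, s3) = ter_of A s x y)) \<and>
          ((\<exists>s\<in>carrier (Aut_alg R A). \<exists>x\<in>Units A. \<exists>y\<in>Units A. (s1, s2, s3) = ter_of A s x y) \<longrightarrow>
            ternary_automorphism R A (s1, s2, s3))) \<and>
        short_exact (units_of (RDirProd A (opposite A))) (TerAut R A) (Aut_alg R A)
          (ter_incl A) (ter_proj R A)"
proof -
  interpret assoc_algebra R A
    by fact
  have unique: "\<exists>!(s, x, y)\<in>carrier (Aut_alg R A) \<times> Units A \<times> Units A. t = ter_of A s x y"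
    if t: "ternary_automorphism R A t" for t
  proof -
    obtain s x y where sxy: "s \<in> carrier (Aut_alg R A)" "x \<in> Units A" "y \<in> Units A"
      and t_eq: "t = ter_of A s x y"
      using ternary_automorphism_decomposition[OF t] by blast
    show ?thesis
      by (rule ex1I[where a = "(s, x, y)"]) (use sxy t_eq ter_of_inject in auto)
  qed
  have "ternary_automorphism R A t \<longleftrightarrow>
      (\<exists>!(s, x, y)\<in>carrier (Aut_alg R A) \<times> Units A \<times> Units A. t = ter_of A s x y)" for t
  proof
    assume "\<exists>!(s, x, y)\<in>carrier (Aut_alg R A) \<times> Units A \<times> Units A. t = ter_of A s x y"
    then show "ternary_automorphism R A t"
      by (elim ex1E) (auto simp: ternary_automorphism_ter_of)
  qed (rule unique)
  moreover have "ternary_automorphism R A t"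
    if "\<exists>s\<in>carrier (Aut_alg R A). \<exists>x\<in>Units A. \<exists>y\<in>Units A. t = ter_of A s x y" for t
    using that ternary_automorphism_ter_of by auto
  ultimately show ?thesis
    using short_exact_TerAut by blast
qed

end
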